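(* Let $\mathcal{H}$ be a nontrivial complex Hilbert space, let $A\in\mathcal{B}(\mathcal{H})$ be positive and nonzero, let $\mathbb{T}=\{\lambda\in\mathbb{C}:|\lambda|=1\}$, and let $T,S\in\mathcal{B}_{A^{1/2}}(\mathcal{H})$. Then the following conditions are equivalent: (1) $T\parallel_A S$. (2) $T\perp_A^{BJ}\big(\|S\|_AT-\lambda\|T\|_AS\big)$ for some $\lambda\in\mathbb{T}$. (3) $S\perp_A^{BJ}\big(\lambda\|T\|_AS-\|S\|_AT\big)$ for some $\lambda\in\mathbb{T}$. If in addition $\|T\|_A\|S\|_A\neq0$, then (1) to (3) are also equivalent to each of: (4) There exist a sequence $\{x_n\}$ of $A$-unit vectors in $\mathcal{H}$ and $\lambda\in\mathbb{T}$ such that $\lim_{n\to\infty}\|Sx_n\|_A=\|S\|_A$ and $\lim_{n\to\infty}\left\|Tx_n-\lambda\frac{\|T\|_A}{\|S\|_A}Sx_n\right\|_A=0$. (5) There exist a sequence $\{x_n\}$ of $A$-unit vectors in $\mathcal{H}$ and $\lambda\in\mathbb{T}$ such that $\lim_{n\to\infty}\|Tx_n\|_A=\|T\|_A$ and $\lim_{n\to\infty}\left\|Sx_n-\lambda\frac{\|S\|_A}{\|T\|_A}Tx_n\right\|_A=0$.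
   Context: $\mathcal{B}(\mathcal{H})$ denotes the bounded linear operators on $\mathcal{H}$. Positive means $\langle Ax,x\rangle\ge 0$ for all $x$. Put $\langle x,y\rangle_A=\langle Ax,y\rangle$ and $\|x\|_A=\sqrt{\langle x,x\rangle_A}$; $x$ is an $A$-unit vector if $\|x\|_A=1$. $\mathcal{B}_{A^{1/2}}(\mathcal{H})$ is the set of $A$-bounded operators, i.e. those $T\in\mathcal{B}(\mathcal{H})$ for which there is $c>0$ with $\|Tx\|_A\le c\|x\|_A$ for all $x\in\mathcal{H}$; for such $T$, $\|T\|_A=\sup\{\|Tx\|_A : x\in\mathcal{H},\ \|x\|_A=1\}$. For $T,S\in\mathcal{B}_{A^{1/2}}(\mathcal{H})$: $T\parallel_A S$ ($A$-norm-parallel) means that there is $\lambda\in\mathbb{T}$ with $\|T+\lambda S\|_A=\|T\|_A+\|S\|_A$; and $T\perp_A^{BJ}S$ ($A$-Birkhoff-James orthogonal) means $\|T+\gamma S\|_A\ge\|T\|_A$ for all $\gamma\in\mathbb{C}$. *)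

theory Defs
  imports "HOL-Analysis.Analysis"
begin

(* The inner product is linear in the first argument. The real Banach space operations are
   tied to the complex ones by scaleR_scaleC and norm_eq_sqrt_cinner, so that completeness,
   boundedness and limits are the library notions for the norm of the inner product. *)

class complex_hilbert_space = banach +
  fixes scaleC :: "complex \<Rightarrow> 'a \<Rightarrow> 'a"  (infixr "*\<^sub>C" 75)
    and cinner :: "'a \<Rightarrow> 'a \<Rightarrow> complex"
  assumes scaleC_add_right: "c *\<^sub>C (x + y) = c *\<^sub>C x + c *\<^sub>C y"
    and scaleC_add_left: "(c + d) *\<^sub>C x = c *\<^sub>C x + d *\<^sub>C x"
    and scaleC_scaleC: "c *\<^sub>C d *\<^sub>C x = (c * d) *\<^sub>C x"
    and scaleC_one: "1 *\<^sub>C x = x"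
    and scaleR_scaleC: "r *\<^sub>R x = complex_of_real r *\<^sub>C x"
    and cinner_commute: "cinner x y = cnj (cinner y x)"
    and cinner_add_left: "cinner (x + y) z = cinner x z + cinner y z"
    and cinner_scaleC_left: "cinner (c *\<^sub>C x) y = c * cinner x y"
    and cinner_ge_zero: "cinner x x \<in> \<real>\<^sub>\<ge>\<^sub>0"
    and cinner_eq_zero_iff: "cinner x x = 0 \<longleftrightarrow> x = 0"
    and norm_eq_sqrt_cinner: "norm x = sqrt (Re (cinner x x))"

instantiation complex :: complex_hilbert_space
begin

definition scaleC_complex :: "complex \<Rightarrow> complex \<Rightarrow> complex"
  where "scaleC_complex c x = c * x"

definition cinner_complex :: "complex \<Rightarrow> complex \<Rightarrow> complex"
  where "cinner_complex x y = x * cnj y"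

instance
proof
  fix x :: complex
  have *: "cinner x x = complex_of_real ((cmod x)\<^sup>2)"
    by (simp only: cinner_complex_def complex_norm_square)
  show "cinner x x \<in> \<real>\<^sub>\<ge>\<^sub>0"
    unfolding * by (subst nonneg_Reals_of_real_iff) simp
  show "cinner x x = 0 \<longleftrightarrow> x = 0" "norm x = sqrt (Re (cinner x x))"
    unfolding * by auto
qed (auto simp: scaleC_complex_def cinner_complex_def algebra_simps scaleR_conv_of_real)

end

definition bounded_clinear :: "('h::complex_hilbert_space \<Rightarrow> 'h) \<Rightarrow> bool"
  where "bounded_clinear T \<longleftrightarrow> bounded_linear T \<and> (\<forall>c x. T (c *\<^sub>C x) = c *\<^sub>C T x)"

definition positive_op :: "('h::complex_hilbert_space \<Rightarrow> 'h) \<Rightarrow> bool"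
  where "positive_op A \<longleftrightarrow> bounded_clinear A \<and> (\<forall>x. cinner (A x) x \<in> \<real>\<^sub>\<ge>\<^sub>0)"

definition A_inner :: "('h::complex_hilbert_space \<Rightarrow> 'h) \<Rightarrow> 'h \<Rightarrow> 'h \<Rightarrow> complex"
  where "A_inner A x y = cinner (A x) y"

(* Re is only the coercion to real: A_inner A x x is real and nonnegative for positive A. *)

definition A_norm :: "('h::complex_hilbert_space \<Rightarrow> 'h) \<Rightarrow> 'h \<Rightarrow> real"
  where "A_norm A x = sqrt (Re (A_inner A x x))"

definition A_bounded :: "('h::complex_hilbert_space \<Rightarrow> 'h) \<Rightarrow> ('h \<Rightarrow> 'h) \<Rightarrow> bool"
  where "A_bounded A T \<longleftrightarrow>
    bounded_clinear T \<and> (\<exists>c>0. \<forall>x. A_norm A (T x) \<le> c * A_norm A x)"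

(* The set is nonempty when A is positive and nonzero, and bounded above when T is
   A-bounded; otherwise Sup carries no meaning. *)

definition A_opnorm :: "('h::complex_hilbert_space \<Rightarrow> 'h) \<Rightarrow> ('h \<Rightarrow> 'h) \<Rightarrow> real"
  where "A_opnorm A T = Sup {A_norm A (T x) | x. A_norm A x = 1}"

definition A_norm_parallel ::
    "('h::complex_hilbert_space \<Rightarrow> 'h) \<Rightarrow> ('h \<Rightarrow> 'h) \<Rightarrow> ('h \<Rightarrow> 'h) \<Rightarrow> bool"
  where "A_norm_parallel A T S \<longleftrightarrow>
    (\<exists>l::complex. cmod l = 1 \<and>
      A_opnorm A (\<lambda>x. T x + l *\<^sub>C S x) = A_opnorm A T + A_opnorm A S)"

definition A_BJ_orthogonal ::
    "('h::complex_hilbert_space \<Rightarrow> 'h) \<Rightarrow> ('h \<Rightarrow> 'h) \<Rightarrow> ('h \<Rightarrow> 'h) \<Rightarrow> bool"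
  where "A_BJ_orthogonal A T S \<longleftrightarrow>
    (\<forall>g::complex. A_opnorm A (\<lambda>x. T x + g *\<^sub>C S x) \<ge> A_opnorm A T)"

end

(* The A-norm is the seminorm of a semi-inner product. If ||T + l S|| = ||T|| + ||S||, choose
   A-unit vectors x_n with ||T x_n + l S x_n|| tending to ||T|| + ||S||. Then ||T x_n|| and
   ||S x_n|| tend to the operator norms, and expanding the square shows that
   ||S|| T x_n - l ||T|| S x_n tends to 0 in the A-norm. This gives (2) and (4) at once.
   Conversely, (2) implies (1) by testing orthogonality at the single value
   -1 / (||T|| + ||S||), where the perturbed operator is ||T|| / (||T|| + ||S||) times T + l S;
   (4) implies (1) by the triangle inequality. Statements (3) and (5) are (2) and (4) with T and S
   exchanged and l replaced by its conjugate. *)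

theory Submission
  imports Defs
begin

section \<open>Complex scalars, sesquilinearity and bounded complex-linear maps\<close>

interpretation scaleC: vector_space "scaleC :: complex \<Rightarrow> 'a::complex_hilbert_space \<Rightarrow> 'a"
  by unfold_locales (rule scaleC_add_right scaleC_add_left scaleC_scaleC scaleC_one)+

lemma cinner_add_right: "cinner x (y + z) = cinner x y + cinner x z"
  by (metis cinner_add_left cinner_commute complex_cnj_add)

lemma cinner_scaleC_right: "cinner x (c *\<^sub>C y) = cnj c * cinner x y"
  by (metis cinner_commute cinner_scaleC_left complex_cnj_mult)

lemma bounded_clinear_add: "bounded_clinear T \<Longrightarrow> T (x + y) = T x + T y"
  by (simp add: bounded_clinear_def linear_add bounded_linear.linear)

lemma bounded_clinear_scaleC: "bounded_clinear T \<Longrightarrow> T (c *\<^sub>C x) = c *\<^sub>C T x"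
  by (simp add: bounded_clinear_def)

lemma bounded_linear_scaleC: "bounded_linear (\<lambda>x::'h::complex_hilbert_space. c *\<^sub>C x)"
proof (rule bounded_linear_intro[where K = "cmod c"])
  fix x :: 'h
  have "cinner (c *\<^sub>C x) (c *\<^sub>C x) = complex_of_real ((cmod c)\<^sup>2) * cinner x x"
    by (simp only: cinner_scaleC_left cinner_scaleC_right complex_norm_square mult_ac)
  then show "norm (c *\<^sub>C x) \<le> norm x * cmod c"
    by (simp add: norm_eq_sqrt_cinner[of "c *\<^sub>C x"] norm_eq_sqrt_cinner[of x] real_sqrt_mult
        flip: of_real_power)
qed (simp_all add: scaleC.scale_right_distrib scaleR_scaleC scaleC.scale_left_commute)

lemma bounded_clinear_lincomb:
  assumes "bounded_clinear T" "bounded_clinear S"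
  shows "bounded_clinear (\<lambda>x. T x + c *\<^sub>C S x)"
  using assms unfolding bounded_clinear_def
  by (auto simp: scaleC.scale_right_distrib scaleC.scale_left_commute
      intro!: bounded_linear_add bounded_linear_compose[OF bounded_linear_scaleC])

section \<open>The semi-inner product and the seminorm given by a positive operator\<close>

lemma A_inner_add_left: "positive_op A \<Longrightarrow> A_inner A (x + y) z = A_inner A x z + A_inner A y z"
  by (simp add: A_inner_def positive_op_def bounded_clinear_add cinner_add_left)

lemma A_inner_add_right: "A_inner A x (y + z) = A_inner A x y + A_inner A x z"
  by (simp add: A_inner_def cinner_add_right)

lemma A_inner_scaleC_left: "positive_op A \<Longrightarrow> A_inner A (c *\<^sub>C x) y = c * A_inner A x y"
  by (simp add: A_inner_def positive_op_def bounded_clinear_scaleC cinner_scaleC_left)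

lemma A_inner_scaleC_right: "A_inner A x (c *\<^sub>C y) = cnj c * A_inner A x y"
  by (simp add: A_inner_def cinner_scaleC_right)

lemma A_inner_self_nonneg: "positive_op A \<Longrightarrow> A_inner A x x \<in> \<real>\<^sub>\<ge>\<^sub>0"
  by (simp add: A_inner_def positive_op_def)

lemma A_inner_self_Re: "positive_op A \<Longrightarrow> Re (A_inner A x x) \<ge> 0"
  using A_inner_self_nonneg complex_nonneg_Reals_iff by blast

lemma A_norm_nonneg: "positive_op A \<Longrightarrow> A_norm A x \<ge> 0"
  by (simp add: A_norm_def A_inner_self_Re)

lemma A_norm_power2: "positive_op A \<Longrightarrow> (A_norm A x)\<^sup>2 = Re (A_inner A x x)"
  by (simp add: A_norm_def A_inner_self_Re)

lemma A_norm_scaleC: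
  assumes "positive_op A"
  shows "A_norm A (c *\<^sub>C x) = cmod c * A_norm A x"
proof -
  have "A_inner A (c *\<^sub>C x) (c *\<^sub>C x) = complex_of_real ((cmod c)\<^sup>2) * A_inner A x x"
    by (simp only: A_inner_scaleC_left[OF assms] A_inner_scaleC_right complex_norm_square mult_ac)
  then show ?thesis
    by (simp add: A_norm_def real_sqrt_mult)
qed

text \<open>With real coefficients both cross terms carry the same factor \<open>s * t\<close>, so
  only the sum \<open>A_inner A u v + A_inner A v u\<close> enters, and the case
  \<open>s = t = 1\<close> expresses its real part by A-norms. This polarised form serves both the
  triangle inequality and the limit computation for parallel operators.\<close>

lemma A_norm_lincomb_power2:
  assumes "positive_op A"
  shows "(A_norm A (complex_of_real s *\<^sub>C u + complex_of_real t *\<^sub>C v))\<^sup>2 =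
    s\<^sup>2 * (A_norm A u)\<^sup>2 + t\<^sup>2 * (A_norm A v)\<^sup>2
    + s * t * ((A_norm A (u + v))\<^sup>2 - (A_norm A u)\<^sup>2 - (A_norm A v)\<^sup>2)"
proof -
  have "A_inner A (complex_of_real s *\<^sub>C u + complex_of_real t *\<^sub>C v)
      (complex_of_real s *\<^sub>C u + complex_of_real t *\<^sub>C v) =
    complex_of_real (s\<^sup>2) * A_inner A u u + complex_of_real (t\<^sup>2) * A_inner A v v
    + complex_of_real (s * t) * (A_inner A u v + A_inner A v u)"
    by (simp add: A_inner_add_left[OF assms] A_inner_add_right A_inner_scaleC_left[OF assms]
        A_inner_scaleC_right power2_eq_square distrib_left mult_ac)
  then show ?thesis
    unfolding A_norm_power2[OF assms]
    by (simp add: A_inner_add_left[OF assms] A_inner_add_right flip: of_real_power)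
qed

text \<open>This is the Cauchy-Schwarz argument phrased without inner products: the quadratic form
  in \<open>s\<close> and \<open>t\<close> from \<open>A_norm_lincomb_power2\<close> is nonnegative,
  and this bounds its cross coefficient \<open>w\<^sup>2 - p\<^sup>2 - r\<^sup>2\<close> by
  \<open>2 * p * r\<close>.\<close>

lemma A_norm_triangle:
  assumes "positive_op A"
  shows "A_norm A (u + v) \<le> A_norm A u + A_norm A v"
proof -
  define p r w where "p = A_norm A u" and "r = A_norm A v" and "w = A_norm A (u + v)"
  have nn: "p \<ge> 0" "r \<ge> 0" "w \<ge> 0"
    by (simp_all add: p_def r_def w_def A_norm_nonneg assms)
  have q: "s\<^sup>2 * p\<^sup>2 + t\<^sup>2 * r\<^sup>2 + s * t * (w\<^sup>2 - p\<^sup>2 - r\<^sup>2) \<ge> 0" for s t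
    unfolding p_def r_def w_def A_norm_lincomb_power2[OF assms, symmetric] by simp
  \<comment> \<open>An affine function that is nonnegative on the whole real line cannot have
    positive slope. This covers \<open>p = 0\<close> and \<open>r = 0\<close>, where fixing one
    variable leaves the quadratic form affine in the other. The witness below gives the value
    -1.\<close>
  have zero: "z \<le> 0" if "\<And>t::real. c + t * z \<ge> 0" for c z :: real
  proof (rule ccontr)
    assume "\<not> z \<le> 0"
    with that[of "- (c + 1) / z"] show False by simp
  qed
  consider "p = 0" | "r = 0" | "p > 0" "r > 0"
    using nn by linarith
  then have "w\<^sup>2 \<le> (p + r)\<^sup>2"
  proof cases
    case 1
    with q[of _ 1] zero[of "r\<^sup>2" "w\<^sup>2 - r\<^sup>2"] show ?thesis by simp
  next
    case 2
    with q[of 1] zero[of "p\<^sup>2" "w\<^sup>2 - p\<^sup>2"] show ?thesis by simp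
  next
    case 3
    \<comment> \<open>At \<open>s = r\<close>, \<open>t = - p\<close> both square terms equal
      \<open>p\<^sup>2 * r\<^sup>2\<close>, and the common factor \<open>p * r\<close> is positive
      and can be cancelled.\<close>
    have "p * r * (w\<^sup>2 - p\<^sup>2 - r\<^sup>2) \<le> p * r * (2 * p * r)"
      using q[of r "- p"] by (simp add: power2_eq_square algebra_simps)
    with 3 have "w\<^sup>2 - p\<^sup>2 - r\<^sup>2 \<le> 2 * p * r"
      by (metis mult_le_cancel_left_pos mult_pos_pos)
    then show ?thesis
      by (simp add: power2_sum)
  qed
  with nn show ?thesis
    unfolding p_def r_def w_def by (meson add_nonneg_nonneg power2_le_imp_le)
qed

lemma A_norm_minus: "positive_op A \<Longrightarrow> A_norm A (- x) = A_norm A x"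
  using A_norm_scaleC[of A "- 1" x] by (simp add: scaleC.scale_minus_left)

lemma A_norm_triangle_lower:
  assumes "positive_op A"
  shows "A_norm A u - A_norm A v \<le> A_norm A (u + v)"
  using A_norm_triangle[OF assms, of "u + v" "- v"] by (simp add: A_norm_minus[OF assms])

text \<open>This makes the set in \<open>A_opnorm\<close> nonempty. If the A-norm vanished
  identically, polarisation would kill the whole form \<open>A_inner A\<close>, and taking
  \<open>y = A x\<close> would give \<open>A = 0\<close>. Otherwise some vector has nonzero A-norm
  and can be rescaled.\<close>

lemma ex_A_unit:
  assumes pos: "positive_op A" and "A \<noteq> (\<lambda>x. 0)"
  shows "\<exists>x. A_norm A x = 1"
proof -
  have "\<exists>x. A_norm A x \<noteq> 0"
  proof (rule ccontr)
    assume "\<not> (\<exists>x. A_norm A x \<noteq> 0)"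
    then have "Re (A_inner A x x) = 0" for x
      using A_norm_power2[OF pos, of x] by simp
    then have z: "A_inner A x x = 0" for x
      using A_inner_self_nonneg[OF pos, of x] by (simp add: complex_nonneg_Reals_iff complex_eq_iff)
    have "A_inner A x y = 0" for x y
    proof -
      have "A_inner A x y + A_inner A y x = 0"
        using z[of "x + y"] by (simp add: A_inner_add_left[OF pos] A_inner_add_right z add.commute)
      \<comment> \<open>The vector \<open>x + y\<close> shows that the two mixed terms are negatives
        of each other; \<open>x + \<i> *\<^sub>C y\<close> shows that they are equal. Hence both
        vanish.\<close>
      moreover have "cnj \<i> * A_inner A x y + \<i> * A_inner A y x = 0"
        using z[of "x + \<i> *\<^sub>C y"]
        by (simp add: A_inner_add_left[OF pos] A_inner_add_right A_inner_scaleC_left[OF pos]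
            A_inner_scaleC_right z)
      ultimately show ?thesis
        by (simp add: complex_eq_iff)
    qed
    then have "A x = 0" for x
      unfolding A_inner_def by (metis cinner_eq_zero_iff)
    with assms(2) show False by auto
  qed
  then obtain x where "A_norm A x \<noteq> 0" by blast
  then have "A_norm A (complex_of_real (1 / A_norm A x) *\<^sub>C x) = 1"
    using A_norm_nonneg[OF pos, of x] by (simp add: A_norm_scaleC[OF pos] norm_divide)
  then show ?thesis ..
qed

section \<open>A-bounded operators and their operator seminorm\<close>

lemma A_bounded_lincomb:
  assumes pos: "positive_op A" and "A_bounded A T" "A_bounded A S"
  shows "A_bounded A (\<lambda>x. T x + c *\<^sub>C S x)"
proof -
  obtain k m where k: "k > 0" "\<And>x. A_norm A (T x) \<le> k * A_norm A x"
    and m: "m > 0" "\<And>x. A_norm A (S x) \<le> m * A_norm A x"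
    using assms(2,3) by (auto simp: A_bounded_def)
  have "A_norm A (T x + c *\<^sub>C S x) \<le> (k + cmod c * m) * A_norm A x" for x
  proof -
    have "A_norm A (T x + c *\<^sub>C S x) \<le> A_norm A (T x) + cmod c * A_norm A (S x)"
      using A_norm_triangle[OF pos, of "T x" "c *\<^sub>C S x"] by (simp add: A_norm_scaleC[OF pos])
    also have "\<dots> \<le> k * A_norm A x + cmod c * (m * A_norm A x)"
      by (intro add_mono k m mult_left_mono) simp
    finally show ?thesis by (simp add: algebra_simps)
  qed
  moreover have "k + cmod c * m > 0"
    using k m by (simp add: add_pos_nonneg)
  ultimately show ?thesis
    using assms by (auto simp: A_bounded_def bounded_clinear_lincomb)
qed

lemma A_opnorm_upper:
  assumes "A_bounded A T" "A_norm A x = 1"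
  shows "A_norm A (T x) \<le> A_opnorm A T"
  unfolding A_opnorm_def
proof (rule cSup_upper)
  obtain k where "\<And>x. A_norm A (T x) \<le> k * A_norm A x"
    using assms(1) by (auto simp: A_bounded_def)
  then have "A_norm A (T x) \<le> k" if "A_norm A x = 1" for x
    by (metis that mult_1_right)
  then show "bdd_above {A_norm A (T x) |x. A_norm A x = 1}"
    by (auto intro!: bdd_aboveI[of _ k])
qed (use assms(2) in blast)

lemma A_opnorm_least:
  assumes "positive_op A" "A \<noteq> (\<lambda>x. 0)" "\<And>x. A_norm A x = 1 \<Longrightarrow> A_norm A (T x) \<le> M"
  shows "A_opnorm A T \<le> M"
  unfolding A_opnorm_def
  by (rule cSup_least) (use ex_A_unit[OF assms(1,2)] assms(3) in auto)

lemma A_opnorm_nonneg: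
  assumes "positive_op A" "A \<noteq> (\<lambda>x. 0)" "A_bounded A T"
  shows "A_opnorm A T \<ge> 0"
  using ex_A_unit[OF assms(1,2)] A_opnorm_upper[OF assms(3)] A_norm_nonneg[OF assms(1)]
  by (meson order_trans)

lemma A_opnorm_scaleC:
  assumes "positive_op A" "A \<noteq> (\<lambda>x. 0)" "A_bounded A T"
  shows "A_opnorm A (\<lambda>x. c *\<^sub>C T x) \<le> cmod c * A_opnorm A T"
  by (rule A_opnorm_least[OF assms(1,2)])
    (simp add: A_norm_scaleC[OF assms(1)] A_opnorm_upper[OF assms(3)] mult_left_mono)

lemma A_opnorm_triangle:
  assumes "positive_op A" "A \<noteq> (\<lambda>x. 0)" "A_bounded A T" "A_bounded A S"
  shows "A_opnorm A (\<lambda>x. T x + c *\<^sub>C S x) \<le> A_opnorm A T + cmod c * A_opnorm A S"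
proof (rule A_opnorm_least[OF assms(1,2)])
  fix x assume x: "A_norm A x = 1"
  have "A_norm A (T x + c *\<^sub>C S x) \<le> A_norm A (T x) + cmod c * A_norm A (S x)"
    using A_norm_triangle[OF assms(1), of "T x" "c *\<^sub>C S x"] by (simp add: A_norm_scaleC[OF assms(1)])
  also have "\<dots> \<le> A_opnorm A T + cmod c * A_opnorm A S"
    by (intro add_mono mult_left_mono A_opnorm_upper x assms) simp
  finally show "A_norm A (T x + c *\<^sub>C S x) \<le> A_opnorm A T + cmod c * A_opnorm A S" .
qed

section \<open>Norming sequences of A-unit vectors\<close>

lemma A_opnorm_norming_sequence:
  assumes "positive_op A" "A \<noteq> (\<lambda>x. 0)" "A_bounded A T"
  obtains X :: "nat \<Rightarrow> 'h::complex_hilbert_space"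
  where "\<And>n. A_norm A (X n) = 1" "(\<lambda>n. A_norm A (T (X n))) \<longlonglongrightarrow> A_opnorm A T"
proof -
  have "\<exists>x. A_norm A x = 1 \<and> A_norm A (T x) > A_opnorm A T - 1 / real (Suc n)" for n
  proof (rule ccontr)
    assume "\<not> ?thesis"
    then have "A_opnorm A T \<le> A_opnorm A T - 1 / real (Suc n)"
      by (intro A_opnorm_least[OF assms(1,2)]) (auto simp: not_less)
    then show False by simp
  qed
  then obtain X where X: "\<And>n. A_norm A (X n) = 1"
    "\<And>n. A_norm A (T (X n)) > A_opnorm A T - 1 / real (Suc n)"
    by metis
  have "(\<lambda>n. A_norm A (T (X n))) \<longlonglongrightarrow> A_opnorm A T"
  proof (rule tendsto_sandwich[OF _ _ _ tendsto_const])
    show "(\<lambda>n. A_opnorm A T - 1 / real (Suc n)) \<longlonglongrightarrow> A_opnorm A T"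
      using tendsto_diff[OF tendsto_const LIMSEQ_Suc[OF lim_1_over_n]] by simp
    show "\<forall>\<^sub>F n in sequentially. A_opnorm A T - 1 / real (Suc n) \<le> A_norm A (T (X n))"
      by (intro always_eventually allI less_imp_le X(2))
    show "\<forall>\<^sub>F n in sequentially. A_norm A (T (X n)) \<le> A_opnorm A T"
      by (intro always_eventually allI A_opnorm_upper[OF assms(3) X(1)])
  qed
  with X(1) show ?thesis by (rule that)
qed

text \<open>All lower bounds by limits pass through here, with \<open>f\<close> supplied by the
  reverse triangle inequality.\<close>

lemma A_opnorm_ge_limit:
  assumes "A_bounded A T" "\<And>n. A_norm A (X n) = 1"
    "\<And>n. f n \<le> A_norm A (T (X n))" "f \<longlonglongrightarrow> M"
  shows "M \<le> A_opnorm A T"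
  using assms by (intro LIMSEQ_le_const2[OF assms(4)]) (meson A_opnorm_upper order_trans)

text \<open>Both characterisations draw their forward direction from this one sequence. The last
  limit is stated without division, so it remains meaningful when one of the operator seminorms is
  zero.\<close>

lemma A_parallel_norming_sequence:
  assumes pos: "positive_op A" "A \<noteq> (\<lambda>x. 0)" and T: "A_bounded A T" and S: "A_bounded A S"
    and l: "cmod l = 1"
    and par: "A_opnorm A (\<lambda>x. T x + l *\<^sub>C S x) = A_opnorm A T + A_opnorm A S"
  obtains X :: "nat \<Rightarrow> 'h::complex_hilbert_space"
  where "\<And>n. A_norm A (X n) = 1"
    "(\<lambda>n. A_norm A (T (X n))) \<longlonglongrightarrow> A_opnorm A T"
    "(\<lambda>n. A_norm A (S (X n))) \<longlonglongrightarrow> A_opnorm A S"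
    "(\<lambda>n. A_norm A (complex_of_real (A_opnorm A S) *\<^sub>C T (X n)
        - (l * complex_of_real (A_opnorm A T)) *\<^sub>C S (X n))) \<longlonglongrightarrow> 0"
proof -
  define a b where "a = A_opnorm A T" and "b = A_opnorm A S"
  obtain X where X: "\<And>n. A_norm A (X n) = 1"
    and lim: "(\<lambda>n. A_norm A (T (X n) + l *\<^sub>C S (X n))) \<longlonglongrightarrow> a + b"
    using A_opnorm_norming_sequence[OF pos A_bounded_lincomb[OF pos(1) T S, of l]] par
    unfolding a_def b_def by metis
  have le: "A_norm A (T (X n)) \<le> a" "A_norm A (S (X n)) \<le> b" for n
    by (simp_all add: a_def b_def A_opnorm_upper T S X)
  have tri: "A_norm A (T (X n) + l *\<^sub>C S (X n)) \<le> A_norm A (T (X n)) + A_norm A (S (X n))" for n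
    using A_norm_triangle[OF pos(1), of "T (X n)" "l *\<^sub>C S (X n)"]
    by (simp add: A_norm_scaleC[OF pos(1)] l)
  \<comment> \<open>Neither summand can exceed its own bound \<open>a\<close> or \<open>b\<close>,
    so a sum that approaches \<open>a + b\<close> forces each summand to its bound.\<close>
  have Ta: "(\<lambda>n. A_norm A (T (X n))) \<longlonglongrightarrow> a"
  proof (rule tendsto_sandwich[OF _ _ _ tendsto_const])
    show "(\<lambda>n. A_norm A (T (X n) + l *\<^sub>C S (X n)) - b) \<longlonglongrightarrow> a"
      using tendsto_diff[OF lim tendsto_const[of b]] by simp
    show "\<forall>\<^sub>F n in sequentially. A_norm A (T (X n) + l *\<^sub>C S (X n)) - b \<le> A_norm A (T (X n))"
      using tri le(2) by (intro always_eventually) (smt (verit))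
  qed (simp add: le)
  have Sb: "(\<lambda>n. A_norm A (S (X n))) \<longlonglongrightarrow> b"
  proof (rule tendsto_sandwich[OF _ _ _ tendsto_const])
    show "(\<lambda>n. A_norm A (T (X n) + l *\<^sub>C S (X n)) - a) \<longlonglongrightarrow> b"
      using tendsto_diff[OF lim tendsto_const[of a]] by simp
    show "\<forall>\<^sub>F n in sequentially. A_norm A (T (X n) + l *\<^sub>C S (X n)) - a \<le> A_norm A (S (X n))"
      using tri le(1) by (intro always_eventually) (smt (verit))
  qed (simp add: le)
  \<comment> \<open>The polarised identity with coefficients \<open>b\<close> and \<open>- a\<close>
    at the vectors \<open>T x\<close> and \<open>l *\<^sub>C S x\<close>. Every A-norm on the right
    has a known limit along \<open>X\<close>, and the limits cancel because the bracket tends to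
    \<open>2 * a * b\<close>.\<close>
  have sq: "(A_norm A (complex_of_real b *\<^sub>C T x - (l * complex_of_real a) *\<^sub>C S x))\<^sup>2 =
    b\<^sup>2 * (A_norm A (T x))\<^sup>2 + a\<^sup>2 * (A_norm A (S x))\<^sup>2
    - b * a * ((A_norm A (T x + l *\<^sub>C S x))\<^sup>2 - (A_norm A (T x))\<^sup>2 - (A_norm A (S x))\<^sup>2)" for x
    using A_norm_lincomb_power2[OF pos(1), of b "T x" "- a" "l *\<^sub>C S x"]
    by (simp add: A_norm_scaleC[OF pos(1)] l scaleC.scale_minus_left mult.commute)
  have "(\<lambda>n. (A_norm A (complex_of_real b *\<^sub>C T (X n) - (l * complex_of_real a) *\<^sub>C S (X n)))\<^sup>2)
      \<longlonglongrightarrow> b\<^sup>2 * a\<^sup>2 + a\<^sup>2 * b\<^sup>2 - b * a * ((a + b)\<^sup>2 - a\<^sup>2 - b\<^sup>2)"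
    unfolding sq by (intro tendsto_intros Ta Sb lim)
  also have "b\<^sup>2 * a\<^sup>2 + a\<^sup>2 * b\<^sup>2 - b * a * ((a + b)\<^sup>2 - a\<^sup>2 - b\<^sup>2) = 0"
    by (simp add: power2_eq_square algebra_simps)
  finally have "(\<lambda>n. sqrt ((A_norm A (complex_of_real b *\<^sub>C T (X n)
      - (l * complex_of_real a) *\<^sub>C S (X n)))\<^sup>2)) \<longlonglongrightarrow> sqrt 0"
    by (rule tendsto_real_sqrt)
  then have "(\<lambda>n. A_norm A (complex_of_real b *\<^sub>C T (X n)
      - (l * complex_of_real a) *\<^sub>C S (X n))) \<longlonglongrightarrow> 0"
    by (simp add: A_norm_nonneg pos)
  with X Ta Sb that show ?thesis
    unfolding a_def b_def by blast
qed

section \<open>Symmetry and characterisations of A-norm parallelism\<close>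

lemma A_norm_parallel_commute:
  assumes "positive_op A" "A_norm_parallel A T S"
  shows "A_norm_parallel A S T"
proof -
  obtain l where l: "cmod l = 1" "A_opnorm A (\<lambda>x. T x + l *\<^sub>C S x) = A_opnorm A T + A_opnorm A S"
    using assms(2) by (auto simp: A_norm_parallel_def)
  \<comment> \<open>The two sums differ by the factor \<open>cnj l\<close> of modulus 1, which
    preserves A-norms.\<close>
  have "S x + cnj l *\<^sub>C T x = cnj l *\<^sub>C (T x + l *\<^sub>C S x)" for x
    using l(1) complex_norm_square[of l]
    by (simp add: scaleC.scale_right_distrib mult.commute add.commute)
  then have "A_opnorm A (\<lambda>x. S x + cnj l *\<^sub>C T x) = A_opnorm A (\<lambda>x. T x + l *\<^sub>C S x)"
    unfolding A_opnorm_def by (simp add: A_norm_scaleC[OF assms(1)] l(1))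
  with l show ?thesis
    by (auto simp: A_norm_parallel_def intro!: exI[of _ "cnj l"])
qed

text \<open>The opposite inequality always holds by \<open>A_opnorm_triangle\<close>, so a lower
  bound on the combined operator is enough.\<close>

lemma A_norm_parallelI:
  assumes "positive_op A" "A \<noteq> (\<lambda>x. 0)" "A_bounded A T" "A_bounded A S" "cmod l = 1"
    and "A_opnorm A T + A_opnorm A S \<le> A_opnorm A (\<lambda>x. T x + l *\<^sub>C S x)"
  shows "A_norm_parallel A T S"
  using A_opnorm_triangle[OF assms(1-4), of l] assms(5,6)
  by (auto simp: A_norm_parallel_def intro!: exI[of _ l])

text \<open>Along the norming sequence \<open>?R l (X n)\<close> tends to 0 in the A-norm, so adding
  any multiple of \<open>?R l\<close> leaves the limit of \<open>A_norm A (T (X n))\<close>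
  unchanged. Conversely a single scalar suffices, except that a factor \<open>a\<close> must be
  cancelled at the end; this is why \<open>a = 0\<close> is treated apart.\<close>

lemma A_norm_parallel_iff_BJ:
  assumes pos: "positive_op A" "A \<noteq> (\<lambda>x. 0)" and T: "A_bounded A T" and S: "A_bounded A S"
  shows "A_norm_parallel A T S \<longleftrightarrow>
    (\<exists>l::complex. cmod l = 1 \<and>
      A_BJ_orthogonal A T
        (\<lambda>x. complex_of_real (A_opnorm A S) *\<^sub>C T x
             - (l * complex_of_real (A_opnorm A T)) *\<^sub>C S x))"
    (is "_ \<longleftrightarrow> (\<exists>l. cmod l = 1 \<and> A_BJ_orthogonal A T (?R l))")
proof
  assume "A_norm_parallel A T S"
  then obtain l where l: "cmod l = 1"
    "A_opnorm A (\<lambda>x. T x + l *\<^sub>C S x) = A_opnorm A T + A_opnorm A S"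
    by (auto simp: A_norm_parallel_def)
  obtain X where X: "\<And>n. A_norm A (X n) = 1"
    "(\<lambda>n. A_norm A (T (X n))) \<longlonglongrightarrow> A_opnorm A T" "(\<lambda>n. A_norm A (?R l (X n))) \<longlonglongrightarrow> 0"
    by (rule A_parallel_norming_sequence[OF assms l]) (rule that)
  have "A_opnorm A T \<le> A_opnorm A (\<lambda>x. T x + g *\<^sub>C ?R l x)" for g
  proof (rule A_opnorm_ge_limit)
    define a b where "a = complex_of_real (A_opnorm A T)" and "b = complex_of_real (A_opnorm A S)"
    \<comment> \<open>The perturbed operator is regrouped so that \<open>A_bounded_lincomb\<close>
      applies twice.\<close>
    have "A_bounded A (\<lambda>x. (T x + (g * b) *\<^sub>C T x) + (- g * l * a) *\<^sub>C S x)"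
      by (intro A_bounded_lincomb pos T S)
    then show "A_bounded A (\<lambda>x. T x + g *\<^sub>C ?R l x)"
      by (simp add: a_def b_def scaleC.scale_right_diff_distrib algebra_simps scaleC.scale_minus_left)
    show "A_norm A (T (X n)) - cmod g * A_norm A (?R l (X n))
        \<le> A_norm A (T (X n) + g *\<^sub>C ?R l (X n))" for n
      using A_norm_triangle_lower[OF pos(1), of "T (X n)" "g *\<^sub>C ?R l (X n)"]
      by (simp only: A_norm_scaleC[OF pos(1)])
    show "(\<lambda>n. A_norm A (T (X n)) - cmod g * A_norm A (?R l (X n))) \<longlonglongrightarrow> A_opnorm A T"
      using tendsto_diff[OF X(2) tendsto_mult[OF tendsto_const[of "cmod g"] X(3)]] by simp
  qed (rule X)
  with l show "\<exists>l. cmod l = 1 \<and> A_BJ_orthogonal A T (?R l)"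
    by (auto simp: A_BJ_orthogonal_def)
next
  assume "\<exists>l. cmod l = 1 \<and> A_BJ_orthogonal A T (?R l)"
  then obtain l where l: "cmod l = 1" "A_BJ_orthogonal A T (?R l)"
    by blast
  define a b where "a = A_opnorm A T" and "b = A_opnorm A S"
  have nn: "a \<ge> 0" "b \<ge> 0"
    using A_opnorm_nonneg[OF pos T] A_opnorm_nonneg[OF pos S] by (simp_all add: a_def b_def)
  define P where "P = A_opnorm A (\<lambda>x. T x + l *\<^sub>C S x)"
  have TS: "A_bounded A (\<lambda>x. T x + l *\<^sub>C S x)"
    by (rule A_bounded_lincomb[OF pos(1) T S])
  have "a + b \<le> P"
  proof (cases "a = 0")
    case True
    \<comment> \<open>With \<open>a = 0\<close> every \<open>T x\<close> at an A-unit vector is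
      A-null, so adding it cannot reduce the A-norm of \<open>l *\<^sub>C S x\<close>.\<close>
    have "A_norm A (S x) \<le> P" if "A_norm A x = 1" for x
    proof -
      have "A_norm A (T x) = 0"
        using A_opnorm_upper[OF T that] A_norm_nonneg[OF pos(1), of "T x"] True by (simp add: a_def)
      then have "A_norm A (S x) \<le> A_norm A (T x + l *\<^sub>C S x)"
        using A_norm_triangle_lower[OF pos(1), of "l *\<^sub>C S x" "T x"]
        by (simp add: A_norm_scaleC[OF pos(1)] l add.commute)
      also have "\<dots> \<le> P"
        unfolding P_def using A_opnorm_upper[OF TS that] .
      finally show ?thesis .
    qed
    then show ?thesis
      using A_opnorm_least[OF pos, of S P] True by (simp add: b_def)
  next
    case False
    with nn have ab: "a > 0" "a + b > 0" by auto
    \<comment> \<open>The scalar g = -1 / (a + b) solves 1 + g * b = - g * a, the condition that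
      \<open>T x\<close> and \<open>l *\<^sub>C S x\<close> receive the same coefficient.\<close>
    have eq: "T x + complex_of_real (- 1 / (a + b)) *\<^sub>C ?R l x
        = complex_of_real (a / (a + b)) *\<^sub>C (T x + l *\<^sub>C S x)" for x
    proof -
      have "1 - complex_of_real (b / (a + b)) = complex_of_real (a / (a + b))"
        using ab by (simp add: field_simps flip: of_real_add)
      then have "T x - complex_of_real (b / (a + b)) *\<^sub>C T x = complex_of_real (a / (a + b)) *\<^sub>C T x"
        by (metis scaleC.scale_left_diff_distrib scaleC.scale_one)
      then show ?thesis
        by (simp add: a_def[symmetric] b_def[symmetric] scaleC.scale_right_diff_distrib
            scaleC.scale_right_distrib scaleC.scale_minus_left mult.commute)
    qed
    have "a \<le> A_opnorm A (\<lambda>x. T x + complex_of_real (- 1 / (a + b)) *\<^sub>C ?R l x)"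
      using l(2) unfolding A_BJ_orthogonal_def a_def by blast
    also have "\<dots> \<le> a / (a + b) * P"
      unfolding eq P_def using A_opnorm_scaleC[OF pos TS, of "complex_of_real (a / (a + b))"] ab
      by (simp add: norm_divide flip: of_real_add)
    finally have "a * (a + b) \<le> a * P"
      using ab by (simp add: field_simps)
    with ab show ?thesis
      by (simp only: mult_le_cancel_left_pos)
  qed
  then show "A_norm_parallel A T S"
    using A_norm_parallelI[OF assms l(1)] by (simp add: a_def b_def P_def)
qed

text \<open>Forward, the remainder of \<open>A_parallel_norming_sequence\<close> is divided by
  \<open>b\<close>. Conversely, \<open>T (X n)\<close> is asymptotically \<open>l * (a / b)\<close>
  times \<open>S (X n)\<close>, so it is aligned with \<open>l *\<^sub>C S (X n)\<close> and the
  A-norms add up in the limit.\<close>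

lemma A_norm_parallel_iff_sequence:
  assumes pos: "positive_op A" "A \<noteq> (\<lambda>x. 0)" and T: "A_bounded A T" and S: "A_bounded A S"
    and S0: "A_opnorm A S \<noteq> 0"
  shows "A_norm_parallel A T S \<longleftrightarrow>
    (\<exists>(X :: nat \<Rightarrow> 'h::complex_hilbert_space) (l::complex). (\<forall>n. A_norm A (X n) = 1) \<and> cmod l = 1 \<and>
      (\<lambda>n. A_norm A (S (X n))) \<longlonglongrightarrow> A_opnorm A S \<and>
      (\<lambda>n. A_norm A (T (X n)
         - (l * complex_of_real (A_opnorm A T / A_opnorm A S)) *\<^sub>C S (X n))) \<longlonglongrightarrow> 0)"
proof -
  define a b where "a = A_opnorm A T" and "b = A_opnorm A S"
  have ab: "a \<ge> 0" "b > 0"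
    using A_opnorm_nonneg[OF pos T] A_opnorm_nonneg[OF pos S] S0 by (auto simp: a_def b_def)
  show ?thesis
    unfolding a_def[symmetric] b_def[symmetric]
  proof
    assume "A_norm_parallel A T S"
    then obtain l where l: "cmod l = 1"
      "A_opnorm A (\<lambda>x. T x + l *\<^sub>C S x) = A_opnorm A T + A_opnorm A S"
      by (auto simp: A_norm_parallel_def)
    obtain X where X: "\<And>n. A_norm A (X n) = 1"
      "(\<lambda>n. A_norm A (T (X n))) \<longlonglongrightarrow> a" "(\<lambda>n. A_norm A (S (X n))) \<longlonglongrightarrow> b"
      "(\<lambda>n. A_norm A (complex_of_real b *\<^sub>C T (X n) - (l * complex_of_real a) *\<^sub>C S (X n))) \<longlonglongrightarrow> 0"
      by (rule A_parallel_norming_sequence[OF pos T S l, folded a_def b_def]) (rule that)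
    have eq: "T x - (l * complex_of_real (a / b)) *\<^sub>C S x = complex_of_real (1 / b) *\<^sub>C
        (complex_of_real b *\<^sub>C T x - (l * complex_of_real a) *\<^sub>C S x)" for x
      using ab by (simp add: scaleC.scale_right_diff_distrib)
    have R: "(\<lambda>n. A_norm A (T (X n) - (l * complex_of_real (a / b)) *\<^sub>C S (X n))) \<longlonglongrightarrow> 0"
      unfolding eq A_norm_scaleC[OF pos(1)] by (rule tendsto_mult_right_zero[OF X(4)])
    show "\<exists>X l. (\<forall>n. A_norm A (X n) = 1) \<and> cmod l = 1 \<and>
        (\<lambda>n. A_norm A (S (X n))) \<longlonglongrightarrow> b \<and>
        (\<lambda>n. A_norm A (T (X n) - (l * complex_of_real (a / b)) *\<^sub>C S (X n))) \<longlonglongrightarrow> 0"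
      by (intro exI conjI allI) (rule X(1) l(1) X(3) R)+
  next
    assume "\<exists>X l. (\<forall>n. A_norm A (X n) = 1) \<and> cmod l = 1 \<and>
        (\<lambda>n. A_norm A (S (X n))) \<longlonglongrightarrow> b \<and>
        (\<lambda>n. A_norm A (T (X n) - (l * complex_of_real (a / b)) *\<^sub>C S (X n))) \<longlonglongrightarrow> 0"
    then obtain X l where X: "\<And>n. A_norm A (X n) = 1" and l: "cmod l = 1"
      and Sb: "(\<lambda>n. A_norm A (S (X n))) \<longlonglongrightarrow> b"
      and R: "(\<lambda>n. A_norm A (T (X n) - (l * complex_of_real (a / b)) *\<^sub>C S (X n))) \<longlonglongrightarrow> 0"
      by blast
    have "a + b \<le> A_opnorm A (\<lambda>x. T x + l *\<^sub>C S x)"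
    proof (rule A_opnorm_ge_limit)
      show "A_bounded A (\<lambda>x. T x + l *\<^sub>C S x)"
        by (rule A_bounded_lincomb[OF pos(1) T S])
      show "(a / b + 1) * A_norm A (S (X n))
          - A_norm A (T (X n) - (l * complex_of_real (a / b)) *\<^sub>C S (X n))
          \<le> A_norm A (T (X n) + l *\<^sub>C S (X n))" for n
      proof -
        define R where "R = T (X n) - (l * complex_of_real (a / b)) *\<^sub>C S (X n)"
        \<comment> \<open>Writing \<open>T (X n)\<close> as its approximant plus the remainder
          \<open>R\<close> collects all of the main part on \<open>S (X n)\<close>; its A-norm tends
          to \<open>(a / b + 1) * b = a + b\<close>.\<close>
        have "(l * complex_of_real (a / b + 1)) *\<^sub>C S (X n) + R = T (X n) + l *\<^sub>C S (X n)"
          by (simp add: R_def distrib_left scaleC.scale_left_distrib)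
        moreover have "A_norm A ((l * complex_of_real (a / b + 1)) *\<^sub>C S (X n))
            = (a / b + 1) * A_norm A (S (X n))"
          using ab by (simp only: A_norm_scaleC[OF pos(1)] norm_mult l norm_of_real) simp
        ultimately show ?thesis
          using A_norm_triangle_lower[OF pos(1), of "(l * complex_of_real (a / b + 1)) *\<^sub>C S (X n)" R]
          unfolding R_def[symmetric] by simp
      qed
      have "(\<lambda>n. (a / b + 1) * A_norm A (S (X n))
          - A_norm A (T (X n) - (l * complex_of_real (a / b)) *\<^sub>C S (X n)))
          \<longlonglongrightarrow> (a / b + 1) * b - 0"
        by (intro tendsto_intros Sb R)
      also have "(a / b + 1) * b - 0 = a + b"
        using ab by (simp add: field_simps)
      finally show "(\<lambda>n. (a / b + 1) * A_norm A (S (X n))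
          - A_norm A (T (X n) - (l * complex_of_real (a / b)) *\<^sub>C S (X n))) \<longlonglongrightarrow> a + b" .
    qed (rule X)
    then show "A_norm_parallel A T S"
      using A_norm_parallelI[OF pos T S l] by (simp add: a_def b_def)
  qed
qed

text \<open>Perturbing by \<open>g\<close> times \<open>c *\<^sub>C R x\<close> is perturbing by
  \<open>g * c\<close> times \<open>R x\<close>, which the quantifier over scalars already covers.
  It lets a unimodular factor move between the two terms of condition (3).\<close>

lemma A_BJ_orthogonal_scaleC:
  assumes "A_BJ_orthogonal A T R"
  shows "A_BJ_orthogonal A T (\<lambda>x. c *\<^sub>C R x)"
  using assms by (simp add: A_BJ_orthogonal_def)

theorem theorem3p1:
  fixes A T S :: "'h::complex_hilbert_space \<Rightarrow> 'h"
  assumes "\<exists>x::'h. x \<noteq> 0"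
    and "positive_op A" and "A \<noteq> (\<lambda>x. 0)"
    and "A_bounded A T" and "A_bounded A S"
  shows "(A_norm_parallel A T S \<longleftrightarrow>
            (\<exists>l::complex. cmod l = 1 \<and>
              A_BJ_orthogonal A T
                (\<lambda>x. complex_of_real (A_opnorm A S) *\<^sub>C T x
                     - (l * complex_of_real (A_opnorm A T)) *\<^sub>C S x)))
       \<and> (A_norm_parallel A T S \<longleftrightarrow>
            (\<exists>l::complex. cmod l = 1 \<and>
              A_BJ_orthogonal A S
                (\<lambda>x. (l * complex_of_real (A_opnorm A T)) *\<^sub>C S x
                     - complex_of_real (A_opnorm A S) *\<^sub>C T x)))
       \<and> (A_opnorm A T * A_opnorm A S \<noteq> 0 \<longrightarrow>
            (A_norm_parallel A T S \<longleftrightarrow>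
              (\<exists>(X :: nat \<Rightarrow> 'h) (l::complex). (\<forall>n. A_norm A (X n) = 1) \<and> cmod l = 1 \<and>
                (\<lambda>n. A_norm A (S (X n))) \<longlonglongrightarrow> A_opnorm A S \<and>
                (\<lambda>n. A_norm A (T (X n)
                   - (l * complex_of_real (A_opnorm A T / A_opnorm A S)) *\<^sub>C S (X n))) \<longlonglongrightarrow> 0))
          \<and> (A_norm_parallel A T S \<longleftrightarrow>
              (\<exists>(X :: nat \<Rightarrow> 'h) (l::complex). (\<forall>n. A_norm A (X n) = 1) \<and> cmod l = 1 \<and>
                (\<lambda>n. A_norm A (T (X n))) \<longlonglongrightarrow> A_opnorm A T \<and>
                (\<lambda>n. A_norm A (S (X n)
                   - (l * complex_of_real (A_opnorm A S / A_opnorm A T)) *\<^sub>C T (X n))) \<longlonglongrightarrow> 0)))"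
proof -
  note pos = assms(2,3) and T = assms(4) and S = assms(5)
  have comm: "A_norm_parallel A T S \<longleftrightarrow> A_norm_parallel A S T"
    using A_norm_parallel_commute[OF pos(1)] by blast
  define a b where "a = complex_of_real (A_opnorm A T)" and "b = complex_of_real (A_opnorm A S)"
  \<comment> \<open>Exchanging \<open>T\<close> and \<open>S\<close> in the orthogonality criterion
    puts the unimodular scalar on \<open>T\<close>, whereas condition (3) has it on
    \<open>S\<close>. Multiplication by \<open>cnj l\<close> passes from either form to the other,
    with \<open>cnj l\<close> as the new scalar.\<close>
  have BJ: "(\<exists>l. cmod l = 1 \<and> A_BJ_orthogonal A S (\<lambda>x. a *\<^sub>C S x - (l * b) *\<^sub>C T x)) \<longleftrightarrow>
      (\<exists>l. cmod l = 1 \<and> A_BJ_orthogonal A S (\<lambda>x. (l * a) *\<^sub>C S x - b *\<^sub>C T x))"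
    (is "?L \<longleftrightarrow> ?R")
  proof -
    have unit: "l * cnj l = 1" "cnj l * l = 1" if "cmod l = 1" for l
      using that complex_norm_square[of l] by (simp_all add: mult.commute)
    have fwd: "(cnj l * a) *\<^sub>C S x - b *\<^sub>C T x = cnj l *\<^sub>C (a *\<^sub>C S x - (l * b) *\<^sub>C T x)"
      and bwd: "a *\<^sub>C S x - (cnj l * b) *\<^sub>C T x = cnj l *\<^sub>C ((l * a) *\<^sub>C S x - b *\<^sub>C T x)"
      if "cmod l = 1" for l x
      using unit[OF that] by (simp_all add: scaleC.scale_right_diff_distrib flip: mult.assoc)
    show ?thesis
    proof
      assume ?L
      then obtain l where l: "cmod l = 1"
        "A_BJ_orthogonal A S (\<lambda>x. a *\<^sub>C S x - (l * b) *\<^sub>C T x)"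
        by blast
      have "A_BJ_orthogonal A S (\<lambda>x. (cnj l * a) *\<^sub>C S x - b *\<^sub>C T x)"
        unfolding fwd[OF l(1)] by (rule A_BJ_orthogonal_scaleC[OF l(2)])
      with l(1) show ?R by (intro exI[of _ "cnj l"]) simp
    next
      assume ?R
      then obtain l where l: "cmod l = 1"
        "A_BJ_orthogonal A S (\<lambda>x. (l * a) *\<^sub>C S x - b *\<^sub>C T x)"
        by blast
      have "A_BJ_orthogonal A S (\<lambda>x. a *\<^sub>C S x - (cnj l * b) *\<^sub>C T x)"
        unfolding bwd[OF l(1)] by (rule A_BJ_orthogonal_scaleC[OF l(2)])
      with l(1) show ?L by (intro exI[of _ "cnj l"]) simp
    qed
  qed
  show ?thesis
  proof (intro conjI impI)
    show "A_norm_parallel A T S \<longleftrightarrow> (\<exists>l. cmod l = 1 \<and> A_BJ_orthogonal A S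
        (\<lambda>x. (l * complex_of_real (A_opnorm A T)) *\<^sub>C S x - complex_of_real (A_opnorm A S) *\<^sub>C T x))"
      using comm A_norm_parallel_iff_BJ[OF pos S T] BJ unfolding a_def b_def by simp
    assume "A_opnorm A T * A_opnorm A S \<noteq> 0"
    then have nz: "A_opnorm A T \<noteq> 0" "A_opnorm A S \<noteq> 0" by auto
    \<comment> \<open>Condition (5) is the sequence criterion for the exchanged pair, which divides
      by \<open>A_opnorm A T\<close>; symmetry restores the order \<open>T\<close>, \<open>S\<close>
      on its left side.\<close>
    note A_norm_parallel_iff_sequence[OF pos T S nz(2)]
      A_norm_parallel_iff_sequence[OF pos S T nz(1), folded comm]
    then show "A_norm_parallel A T S \<longleftrightarrow>
        (\<exists>X l. (\<forall>n. A_norm A (X n) = 1) \<and> cmod l = 1 \<and>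
          (\<lambda>n. A_norm A (S (X n))) \<longlonglongrightarrow> A_opnorm A S \<and>
          (\<lambda>n. A_norm A (T (X n)
            - (l * complex_of_real (A_opnorm A T / A_opnorm A S)) *\<^sub>C S (X n))) \<longlonglongrightarrow> 0)"
      and "A_norm_parallel A T S \<longleftrightarrow>
        (\<exists>X l. (\<forall>n. A_norm A (X n) = 1) \<and> cmod l = 1 \<and>
          (\<lambda>n. A_norm A (T (X n))) \<longlonglongrightarrow> A_opnorm A T \<and>
          (\<lambda>n. A_norm A (S (X n)
            - (l * complex_of_real (A_opnorm A S / A_opnorm A T)) *\<^sub>C T (X n))) \<longlonglongrightarrow> 0)"
      by blast+
  qed (rule A_norm_parallel_iff_BJ[OF pos T S])
qed

end
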